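(* Let $\mathcal A$ and $\mathfrak A$ be Banach algebras such that $\mathcal A$ is a Banach $\mathfrak A$-bimodule with compatible actions. If $\mathcal A$ and $\mathfrak A$ are cyclicly amenable and $\langle\mathcal A^2\rangle=\mathcal A$, then $\mathcal A\rtimes\mathfrak A$ is cyclicly amenable.
   Context: The actions of $\mathfrak A$ on $\mathcal A$ are compatible if for all $a,b\in\mathcal A$ and $\beta\in\mathfrak A$: $\beta\cdot(ab)=(\beta\cdot a)b$, $(ab)\cdot\beta=a(b\cdot\beta)$, $a(\beta\cdot b)=(a\cdot\beta)b$. The amalgamated duplication $\mathcal A\rtimes\mathfrak A$ is $\mathcal A\times\mathfrak A$ with product $(a,\beta)(b,\gamma)=(ab+a\cdot\gamma+\beta\cdot b,\ \beta\gamma)$ and norm $\|(a,\beta)\|=\|a\|+\|\beta\|$. $\mathcal A^2=\{ab:a,b\in\mathcal A\}$ and $\langle Y\rangle$ is the closed linear span of $Y$. For a Banach algebra $\mathcal C$ with dual $\mathcal C^{(1)}$ (a $\mathcal C$-bimodule via $\langle f\cdot c,d\rangle=\langle f,cd\rangle$, $\langle c\cdot f,d\rangle=\langle f,dc\rangle$), a derivation $D:\mathcal C\to\mathcal C^{(1)}$ is a continuous linear map with $D(c_1c_2)=D(c_1)\cdot c_2+c_1\cdot D(c_2)$; it is cyclic if $\langle D(c_1),c_2\rangle+\langle D(c_2),c_1\rangle=0$ for all $c_1,c_2$, and inner if $D(c)=c\cdot f-f\cdot c$ for some $f\in\mathcal C^{(1)}$. $\mathcal C$ is cyclicly amenable if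 every cyclic derivation $\mathcal C\to\mathcal C^{(1)}$ is inner. *)

theory Defs
  imports "HOL-Analysis.Analysis"
begin

text \<open>
  Scalars range over an arbitrary type of class \<open>real_normed_field\<close>; up to isomorphism the
  only instances are the real and the complex field, so both are covered. A Banach space over
  \<open>'k\<close> is a type of class \<open>banach\<close> with a \<open>'k\<close>-scaling that extends the real one.
\<close>

locale banach_space_over = vector_space sC
  for sC :: "'k::real_normed_field \<Rightarrow> 'c::banach \<Rightarrow> 'c" +
  assumes scale_of_real: "sC (of_real r) x = r *\<^sub>R x"
    and norm_scale: "norm (sC k x) = norm k * norm x"

definition bilinear_over ::
  "('k \<Rightarrow> 'x \<Rightarrow> 'x) \<Rightarrow> ('k \<Rightarrow> 'y \<Rightarrow> 'y) \<Rightarrow> ('k::field \<Rightarrow> 'z \<Rightarrow> 'z)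
    \<Rightarrow> ('x::ab_group_add \<Rightarrow> 'y::ab_group_add \<Rightarrow> 'z::ab_group_add) \<Rightarrow> bool" where
  "bilinear_over sX sY sZ f \<longleftrightarrow>
     (\<forall>y. Vector_Spaces.linear sX sZ (\<lambda>x. f x y)) \<and> (\<forall>x. Vector_Spaces.linear sY sZ (f x))"

text \<open>
  The product is an explicit argument rather than the class operation, because the product of the
  amalgamated duplication depends on the two module actions. Algebras need not be unital.
\<close>

locale banach_algebra = banach_space_over sC
  for sC :: "'k::real_normed_field \<Rightarrow> 'c::banach \<Rightarrow> 'c" +
  fixes mC :: "'c \<Rightarrow> 'c \<Rightarrow> 'c"
  assumes mult_bilinear: "bilinear_over sC sC sC mC"
    and mult_assoc: "mC (mC x y) z = mC x (mC y z)"
    and norm_mult_le: "norm (mC x y) \<le> norm x * norm y"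

text \<open>
  The actions are only required to be bounded; the contractive convention is the case \<open>K = 1\<close>.
\<close>

locale banach_bimodule = alg: banach_algebra sB mB + space: banach_space_over sA
  for sB :: "'k::real_normed_field \<Rightarrow> 'b::banach \<Rightarrow> 'b"
    and mB :: "'b \<Rightarrow> 'b \<Rightarrow> 'b"
    and sA :: "'k \<Rightarrow> 'a::banach \<Rightarrow> 'a" +
  fixes lact :: "'b \<Rightarrow> 'a \<Rightarrow> 'a"
    and ract :: "'a \<Rightarrow> 'b \<Rightarrow> 'a"
  assumes lact_bilinear: "bilinear_over sB sA sA lact"
    and ract_bilinear: "bilinear_over sA sB sA ract"
    and lact_mult: "lact (mB \<beta> \<gamma>) a = lact \<beta> (lact \<gamma> a)"
    and ract_mult: "ract a (mB \<beta> \<gamma>) = ract (ract a \<beta>) \<gamma>"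
    and lact_ract: "ract (lact \<beta> a) \<gamma> = lact \<beta> (ract a \<gamma>)"
    and lact_bounded: "\<exists>K. \<forall>\<beta> a. norm (lact \<beta> a) \<le> K * norm \<beta> * norm a"
    and ract_bounded: "\<exists>K. \<forall>a \<beta>. norm (ract a \<beta>) \<le> K * norm a * norm \<beta>"

definition compatible_actions ::
  "('a \<Rightarrow> 'a \<Rightarrow> 'a) \<Rightarrow> ('b \<Rightarrow> 'a \<Rightarrow> 'a) \<Rightarrow> ('a \<Rightarrow> 'b \<Rightarrow> 'a) \<Rightarrow> bool" where
  "compatible_actions mA lact ract \<longleftrightarrow>
     (\<forall>a b \<beta>. lact \<beta> (mA a b) = mA (lact \<beta> a) b \<and>
              ract (mA a b) \<beta> = mA a (ract b \<beta>) \<and>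
              mA a (lact \<beta> b) = mA (ract a \<beta>) b)"


section \<open>Cyclic amenability\<close>

text \<open>
  Elements of \<open>'c \<Rightarrow>\<^sub>L 'k\<close> are bounded and additive but only real-homogeneous.
\<close>

definition dual_space ::
  "('k::real_normed_field \<Rightarrow> 'c::real_normed_vector \<Rightarrow> 'c) \<Rightarrow> ('c \<Rightarrow>\<^sub>L 'k) set" where
  "dual_space sC = {f. Vector_Spaces.linear sC (*) (blinfun_apply f)}"

definition dual_ract ::
  "('c \<Rightarrow> 'c \<Rightarrow> 'c) \<Rightarrow> ('c::real_normed_vector \<Rightarrow>\<^sub>L 'k::real_normed_field) \<Rightarrow> 'c \<Rightarrow> ('c \<Rightarrow>\<^sub>L 'k)" where
  "dual_ract mC f c = f o\<^sub>L Blinfun (\<lambda>d. mC c d)"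

definition dual_lact ::
  "('c \<Rightarrow> 'c \<Rightarrow> 'c) \<Rightarrow> 'c \<Rightarrow> ('c::real_normed_vector \<Rightarrow>\<^sub>L 'k::real_normed_field) \<Rightarrow> ('c \<Rightarrow>\<^sub>L 'k)" where
  "dual_lact mC c f = f o\<^sub>L Blinfun (\<lambda>d. mC d c)"

lemma dual_ract_apply [simp]:
  "bounded_bilinear mC \<Longrightarrow> blinfun_apply (dual_ract mC f c) d = f (mC c d)"
  by (simp add: dual_ract_def bounded_linear_Blinfun_apply bounded_bilinear.bounded_linear_right)

lemma dual_lact_apply [simp]:
  "bounded_bilinear mC \<Longrightarrow> blinfun_apply (dual_lact mC c f) d = f (mC d c)"
  by (simp add: dual_lact_def bounded_linear_Blinfun_apply bounded_bilinear.bounded_linear_left)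

text \<open>
  \<open>bounded_linear D\<close> is continuity for the operator norm on the dual (and real-linearity); the third
  conjunct is \<open>'k\<close>-homogeneity, the scaling of the dual being pointwise.
\<close>

definition derivation_to_dual ::
  "('k::real_normed_field \<Rightarrow> 'c::real_normed_vector \<Rightarrow> 'c) \<Rightarrow> ('c \<Rightarrow> 'c \<Rightarrow> 'c)
    \<Rightarrow> ('c \<Rightarrow> 'c \<Rightarrow>\<^sub>L 'k) \<Rightarrow> bool" where
  "derivation_to_dual sC mC D \<longleftrightarrow>
     range D \<subseteq> dual_space sC \<and>
     bounded_linear D \<and>
     (\<forall>k c d. D (sC k c) d = k * D c d) \<and>
     (\<forall>c1 c2. D (mC c1 c2) = dual_ract mC (D c1) c2 + dual_lact mC c1 (D c2))"

definition cyclic_map :: "('c::real_normed_vector \<Rightarrow> 'c \<Rightarrow>\<^sub>L 'k::real_normed_field) \<Rightarrow> bool" where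
  "cyclic_map D \<longleftrightarrow> (\<forall>c1 c2. D c1 c2 + D c2 c1 = 0)"

definition inner_map ::
  "('k::real_normed_field \<Rightarrow> 'c::real_normed_vector \<Rightarrow> 'c) \<Rightarrow> ('c \<Rightarrow> 'c \<Rightarrow> 'c)
    \<Rightarrow> ('c \<Rightarrow> 'c \<Rightarrow>\<^sub>L 'k) \<Rightarrow> bool" where
  "inner_map sC mC D \<longleftrightarrow>
     (\<exists>f\<in>dual_space sC. \<forall>c. D c = dual_lact mC c f - dual_ract mC f c)"

definition cyclicly_amenable ::
  "('k::real_normed_field \<Rightarrow> 'c::real_normed_vector \<Rightarrow> 'c) \<Rightarrow> ('c \<Rightarrow> 'c \<Rightarrow> 'c) \<Rightarrow> bool" where
  "cyclicly_amenable sC mC \<longleftrightarrow>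
     (\<forall>D. derivation_to_dual sC mC D \<and> cyclic_map D \<longrightarrow> inner_map sC mC D)"


section \<open>The amalgamated duplication\<close>

text \<open>
  A copy of the product type, since the library norm on \<open>'a \<times> 'b\<close> is the Euclidean one.
\<close>

datatype ('a, 'b) dup = Dup (dfst: 'a) (dsnd: 'b)

instantiation dup :: (ab_group_add, ab_group_add) ab_group_add
begin

definition "0 = Dup 0 0"
definition "x + y = Dup (dfst x + dfst y) (dsnd x + dsnd y)"
definition "x - y = Dup (dfst x - dfst y) (dsnd x - dsnd y)"
definition "- x = Dup (- dfst x) (- dsnd x)"

instance
  by standard
    (auto simp: zero_dup_def plus_dup_def minus_dup_def uminus_dup_def intro: dup.expand)

end

lemma dup_simps [simp]:
  "dfst 0 = 0" "dsnd 0 = 0"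
  "dfst (x + y) = dfst x + dfst y" "dsnd (x + y) = dsnd x + dsnd y"
  "dfst (x - y) = dfst x - dfst y" "dsnd (x - y) = dsnd x - dsnd y"
  "dfst (- x) = - dfst x" "dsnd (- x) = - dsnd x"
  by (simp_all add: zero_dup_def plus_dup_def minus_dup_def uminus_dup_def)

instantiation dup :: (real_normed_vector, real_normed_vector) real_normed_vector
begin

definition "r *\<^sub>R x = Dup (r *\<^sub>R dfst x) (r *\<^sub>R dsnd x)"
definition "norm x = norm (dfst x) + norm (dsnd x)"
definition "sgn x = inverse (norm x) *\<^sub>R x" for x :: "('a, 'b) dup"
definition "dist x y = norm (x - y)" for x y :: "('a, 'b) dup"
definition [code del]:
  "(uniformity :: (('a, 'b) dup \<times> ('a, 'b) dup) filter) =
     (INF e\<in>{0 <..}. principal {(x, y). dist x y < e})"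
definition [code del]:
  "open (U :: ('a, 'b) dup set) \<longleftrightarrow>
     (\<forall>x\<in>U. eventually (\<lambda>(x', y). x' = x \<longrightarrow> y \<in> U) uniformity)"

instance
proof
  fix x y :: "('a, 'b) dup" and r s :: real
  show "r *\<^sub>R (x + y) = r *\<^sub>R x + r *\<^sub>R y" "(r + s) *\<^sub>R x = r *\<^sub>R x + s *\<^sub>R x"
    "r *\<^sub>R s *\<^sub>R x = (r * s) *\<^sub>R x" "1 *\<^sub>R x = x"
    by (auto simp: scaleR_dup_def algebra_simps intro: dup.expand)
  show "norm x = 0 \<longleftrightarrow> x = 0"
    by (cases x) (auto simp: norm_dup_def zero_dup_def add_nonneg_eq_0_iff)
  show "norm (x + y) \<le> norm x + norm y"
    using norm_triangle_ineq[of "dfst x" "dfst y"] norm_triangle_ineq[of "dsnd x" "dsnd y"]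
    by (simp add: norm_dup_def)
  show "norm (r *\<^sub>R x) = \<bar>r\<bar> * norm x"
    by (simp add: norm_dup_def scaleR_dup_def algebra_simps)
qed (auto simp: sgn_dup_def dist_dup_def uniformity_dup_def open_dup_def)

end

lemma norm_dup [simp]: "norm (Dup a \<beta>) = norm a + norm \<beta>"
  by (simp add: norm_dup_def)

lemma tendsto_Dup:
  assumes "X \<longlonglongrightarrow> a" "Y \<longlonglongrightarrow> b"
  shows "(\<lambda>n. Dup (X n) (Y n)) \<longlonglongrightarrow> Dup a b"
proof -
  have "(\<lambda>n. norm (X n - a) + norm (Y n - b)) \<longlonglongrightarrow> 0"
    using tendsto_add[OF tendsto_norm_zero[OF LIM_zero[OF assms(1)]]
        tendsto_norm_zero[OF LIM_zero[OF assms(2)]]] by simp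
  then have "(\<lambda>n. norm (Dup (X n) (Y n) - Dup a b)) \<longlonglongrightarrow> 0"
    by (simp add: norm_dup_def)
  then show ?thesis
    by (metis LIM_zero_cancel tendsto_norm_zero_cancel)
qed

instance dup :: (banach, banach) banach
proof
  fix X :: "nat \<Rightarrow> ('a, 'b) dup"
  assume X: "Cauchy X"
  have d: "dist (dfst x) (dfst y) \<le> dist x y" "dist (dsnd x) (dsnd y) \<le> dist x y"
    for x y :: "('a, 'b) dup"
    by (simp_all add: dist_norm norm_dup_def)
  have "Cauchy (\<lambda>n. dfst (X n))" "Cauchy (\<lambda>n. dsnd (X n))"
    using X d unfolding Cauchy_def by (meson le_less_trans)+
  then obtain a b where "(\<lambda>n. dfst (X n)) \<longlonglongrightarrow> a" "(\<lambda>n. dsnd (X n)) \<longlonglongrightarrow> b"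
    by (meson Cauchy_convergent convergent_def)
  from tendsto_Dup[OF this] show "convergent X"
    by (auto simp: convergent_def)
qed

definition dup_scale ::
  "('k \<Rightarrow> 'a \<Rightarrow> 'a) \<Rightarrow> ('k \<Rightarrow> 'b \<Rightarrow> 'b) \<Rightarrow> 'k \<Rightarrow> ('a, 'b) dup \<Rightarrow> ('a, 'b) dup" where
  "dup_scale sA sB k x = Dup (sA k (dfst x)) (sB k (dsnd x))"

fun dup_mult ::
  "('a::plus \<Rightarrow> 'a \<Rightarrow> 'a) \<Rightarrow> ('b \<Rightarrow> 'b \<Rightarrow> 'b) \<Rightarrow> ('b \<Rightarrow> 'a \<Rightarrow> 'a) \<Rightarrow> ('a \<Rightarrow> 'b \<Rightarrow> 'a)
    \<Rightarrow> ('a, 'b) dup \<Rightarrow> ('a, 'b) dup \<Rightarrow> ('a, 'b) dup" where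
  "dup_mult mA mB lact ract (Dup a \<beta>) (Dup b \<gamma>) =
     Dup (mA a b + ract a \<gamma> + lact \<beta> b) (mB \<beta> \<gamma>)"


section \<open>The duplication is a Banach algebra\<close>

lemma bilinear_overD:
  assumes "bilinear_over sX sY sZ f"
  shows "f (x + x') y = f x y + f x' y" "f x (y + y') = f x y + f x y'"
    "f (sX k x) y = sZ k (f x y)" "f x (sY k y) = sZ k (f x y)"
  using assms unfolding bilinear_over_def
  by (auto dest!: spec simp: Vector_Spaces.linear_iff)

lemma bilinear_overI:
  assumes "vector_space sX" "vector_space sY" "vector_space sZ"
    and "\<And>x x' y. f (x + x') y = f x y + f x' y" "\<And>x y y'. f x (y + y') = f x y + f x y'"
    and "\<And>k x y. f (sX k x) y = sZ k (f x y)" "\<And>k x y. f x (sY k y) = sZ k (f x y)"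
  shows "bilinear_over sX sY sZ f"
  using assms unfolding bilinear_over_def by (auto simp: Vector_Spaces.linear_iff)

lemma (in banach_space_over) banach_space_over_dup_scale:
  assumes "banach_space_over sB"
  shows "banach_space_over (dup_scale sC sB)"
proof -
  interpret B: banach_space_over sB by fact
  show ?thesis
    by standard
      (auto simp: dup_scale_def scaleR_dup_def norm_dup_def scale_of_real B.scale_of_real
        norm_scale B.norm_scale scale_right_distrib B.scale_right_distrib
        scale_left_distrib B.scale_left_distrib distrib_left intro!: dup.expand)
qed

lemma bounded_bilinear_over:
  assumes "banach_space_over sX" "banach_space_over sY" "banach_space_over sZ"
    and f: "bilinear_over sX sY sZ f" and "\<And>x y. norm (f x y) \<le> K * norm x * norm y"
  shows "bounded_bilinear f"
proof
  show "\<exists>K. \<forall>a b. norm (f a b) \<le> norm a * norm b * K"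
    using assms(5) by (intro exI[of _ K]) (simp add: mult_ac)
qed (use bilinear_overD[OF f] in
    \<open>simp_all flip: banach_space_over.scale_of_real[OF assms(1)]
      banach_space_over.scale_of_real[OF assms(2)] banach_space_over.scale_of_real[OF assms(3)]\<close>)

context banach_bimodule
begin

lemma bilinear_dup_mult:
  assumes "banach_algebra sA mA"
  shows "bilinear_over (dup_scale sA sB) (dup_scale sA sB) (dup_scale sA sB)
    (dup_mult mA mB lact ract)"
proof -
  interpret A: banach_algebra sA mA by fact
  interpret D: banach_space_over "dup_scale sA sB"
    using space.banach_space_over_dup_scale alg.banach_space_over_axioms by blast
  note bl = bilinear_overD[OF lact_bilinear] bilinear_overD[OF ract_bilinear]
    bilinear_overD[OF A.mult_bilinear] bilinear_overD[OF alg.mult_bilinear]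
  show ?thesis
  proof (rule bilinear_overI)
    fix x x' y y' :: "('a, 'b) dup" and k :: 'k
    show "dup_mult mA mB lact ract (x + x') y =
        dup_mult mA mB lact ract x y + dup_mult mA mB lact ract x' y"
      by (cases x; cases x'; cases y) (simp add: plus_dup_def bl)
    show "dup_mult mA mB lact ract x (y + y') =
        dup_mult mA mB lact ract x y + dup_mult mA mB lact ract x y'"
      by (cases x; cases y; cases y') (simp add: plus_dup_def bl)
    show "dup_mult mA mB lact ract (dup_scale sA sB k x) y =
        dup_scale sA sB k (dup_mult mA mB lact ract x y)"
      by (cases x; cases y) (simp add: dup_scale_def bl space.scale_right_distrib)
    show "dup_mult mA mB lact ract x (dup_scale sA sB k y) =
        dup_scale sA sB k (dup_mult mA mB lact ract x y)"
      by (cases x; cases y) (simp add: dup_scale_def bl space.scale_right_distrib)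
  qed (rule D.vector_space_axioms)+
qed

lemma bounded_bilinear_dup_mult:
  assumes "banach_algebra sA mA"
  shows "bounded_bilinear (dup_mult mA mB lact ract)"
proof -
  interpret A: banach_algebra sA mA by fact
  have D: "banach_space_over (dup_scale sA sB)"
    using space.banach_space_over_dup_scale alg.banach_space_over_axioms by blast
  obtain K where K: "norm (lact \<beta> a) \<le> K * norm \<beta> * norm a" for \<beta> a
    using lact_bounded by blast
  obtain L where L: "norm (ract a \<beta>) \<le> L * norm a * norm \<beta>" for \<beta> a
    using ract_bounded by blast
  define M where "M = max 1 (max K L)"
  have M: "1 \<le> M" "K \<le> M" "L \<le> M" by (auto simp: M_def)
  show ?thesis
  proof (rule bounded_bilinear_over[OF D D D bilinear_dup_mult[OF assms]])
    fix x y :: "('a, 'b) dup"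
    obtain a \<beta> b \<gamma> where xy: "x = Dup a \<beta>" "y = Dup b \<gamma>" by (meson dup.exhaust)
    have "norm (dup_mult mA mB lact ract x y) \<le>
        norm (mA a b) + norm (ract a \<gamma>) + norm (lact \<beta> b) + norm (mB \<beta> \<gamma>)"
      unfolding xy by (simp add: norm_add_rule_thm)
    also have "\<dots> \<le> M * (norm a * norm b) + M * (norm a * norm \<gamma>) +
        M * (norm \<beta> * norm b) + M * (norm \<beta> * norm \<gamma>)"
    proof (intro add_mono)
      have mono: "t \<le> M * (p * q)" if "t \<le> k * (p * q)" "k \<le> M" "0 \<le> p" "0 \<le> q"
        for t k p q :: real
        using that mult_right_mono[of k M "p * q"] by auto
      show "norm (mA a b) \<le> M * (norm a * norm b)"
        using mono[of _ 1] A.norm_mult_le M by simp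
      show "norm (mB \<beta> \<gamma>) \<le> M * (norm \<beta> * norm \<gamma>)"
        using mono[of _ 1] alg.norm_mult_le M by simp
      show "norm (ract a \<gamma>) \<le> M * (norm a * norm \<gamma>)"
        using mono[of _ L] L M by (simp add: mult.assoc)
      show "norm (lact \<beta> b) \<le> M * (norm \<beta> * norm b)"
        using mono[of _ K] K M by (simp add: mult.assoc)
    qed
    also have "\<dots> = M * norm x * norm y"
      by (simp add: xy algebra_simps)
    finally show "norm (dup_mult mA mB lact ract x y) \<le> M * norm x * norm y" .
  qed
qed

lemma dup_mult_assoc:
  assumes "banach_algebra sA mA" "compatible_actions mA lact ract"
  shows "dup_mult mA mB lact ract (dup_mult mA mB lact ract x y) z =
    dup_mult mA mB lact ract x (dup_mult mA mB lact ract y z)"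
proof -
  interpret A: banach_algebra sA mA by fact
  note bl = bilinear_overD(1,2)[OF lact_bilinear] bilinear_overD(1,2)[OF ract_bilinear]
    bilinear_overD(1,2)[OF A.mult_bilinear]
  have c: "lact \<beta> (mA a b) = mA (lact \<beta> a) b" "ract (mA a b) \<beta> = mA a (ract b \<beta>)"
    "mA a (lact \<beta> b) = mA (ract a \<beta>) b" for a b \<beta>
    using assms(2) unfolding compatible_actions_def by auto
  show ?thesis
    by (cases x; cases y; cases z)
      (simp add: bl c lact_mult ract_mult lact_ract A.mult_assoc alg.mult_assoc add_ac)
qed

theorem banach_algebra_dup:
  assumes "banach_algebra sA mA" "compatible_actions mA lact ract"
    and "\<And>\<beta> a. norm (lact \<beta> a) \<le> norm \<beta> * norm a"
    and "\<And>a \<beta>. norm (ract a \<beta>) \<le> norm a * norm \<beta>"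
  shows "banach_algebra (dup_scale sA sB) (dup_mult mA mB lact ract)"
proof -
  interpret A: banach_algebra sA mA by fact
  interpret D: banach_space_over "dup_scale sA sB"
    using space.banach_space_over_dup_scale alg.banach_space_over_axioms by blast
  show ?thesis
  proof
    fix x y z :: "('a, 'b) dup"
    show "bilinear_over (dup_scale sA sB) (dup_scale sA sB) (dup_scale sA sB)
        (dup_mult mA mB lact ract)"
      by (rule bilinear_dup_mult) fact
    show "dup_mult mA mB lact ract (dup_mult mA mB lact ract x y) z =
        dup_mult mA mB lact ract x (dup_mult mA mB lact ract y z)"
      by (rule dup_mult_assoc) fact+
    obtain a \<beta> b \<gamma> where xy: "x = Dup a \<beta>" "y = Dup b \<gamma>" by (meson dup.exhaust)
    have "norm (dup_mult mA mB lact ract x y) \<le>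
        norm (mA a b) + norm (ract a \<gamma>) + norm (lact \<beta> b) + norm (mB \<beta> \<gamma>)"
      unfolding xy by (simp add: norm_add_rule_thm)
    also have "\<dots> \<le> norm a * norm b + norm a * norm \<gamma> + norm \<beta> * norm b + norm \<beta> * norm \<gamma>"
      by (intro add_mono assms A.norm_mult_le alg.norm_mult_le)
    also have "\<dots> = norm x * norm y"
      by (simp add: xy algebra_simps)
    finally show "norm (dup_mult mA mB lact ract x y) \<le> norm x * norm y" .
  qed
qed

end

end

theory Submission imports Defs begin

text \<open>
  A cyclic derivation \<open>D\<close> of the duplication restricts to a cyclic derivation along each of the
  subalgebras \<open>{(a, 0)}\<close> and \<open>{(0, \<beta>)}\<close> (\<open>cyclic_derivation_inner_along_hom\<close>). Cyclic amenability
  of the two algebras yields functionals \<open>f\<close> and \<open>g\<close> that implement these restrictions. The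
  functional \<open>\<phi> (a, \<beta>) = f a + g \<beta>\<close> then implements all of \<open>D\<close>. What has to be seen is that it
  also gives the mixed values of \<open>D\<close>.

  As \<open>{(a, 0)}\<close> is an ideal, the derivation rule expresses the mixed value \<open>\<langle>D (xy, 0), (0, \<gamma>)\<rangle>\<close>
  by the unmixed values \<open>\<langle>D (x, 0), (y \<cdot> \<gamma>, 0)\<rangle>\<close> and \<open>\<langle>D (y, 0), (\<gamma> \<cdot> x, 0)\<rangle>\<close>, which are
  commutators under \<open>f\<close>. Compatibility of the actions makes two of the four terms cancel and leaves
  \<open>f (\<gamma> \<cdot> xy) - f (xy \<cdot> \<gamma>)\<close>, which is the value of the inner derivation of \<open>\<phi>\<close>
  (\<open>mixed_value_on_product\<close>). The products span a dense subspace, so this extends to all \<open>(a, 0)\<close>.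
  The other mixed values \<open>\<langle>D (0, \<beta>), (b, 0)\<rangle>\<close> follow because \<open>D\<close> is cyclic.
\<close>

lemma (in banach_algebra) bounded_bilinear_mult: "bounded_bilinear mC"
  using bounded_bilinear_over[OF banach_space_over_axioms banach_space_over_axioms
      banach_space_over_axioms mult_bilinear, of 1] norm_mult_le by simp

context banach_bimodule
begin

lemma bounded_bilinear_lact: "bounded_bilinear lact"
  using lact_bounded lact_bilinear
  by (blast intro: bounded_bilinear_over alg.banach_space_over_axioms
      space.banach_space_over_axioms)

lemma bounded_bilinear_ract: "bounded_bilinear ract"
  using ract_bounded ract_bilinear
  by (blast intro: bounded_bilinear_over alg.banach_space_over_axioms
      space.banach_space_over_axioms)

end

lemma derivation_to_dual_mult:
  assumes "derivation_to_dual sC mC D" "bounded_bilinear mC"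
  shows "D (mC x y) z = D x (mC y z) + D y (mC z x)"
  using assms by (simp add: derivation_to_dual_def blinfun.add_left)

text \<open>
  Pulling \<open>D\<close> back along a homomorphism \<open>j\<close> in both arguments keeps the derivation rule and
  cyclicity, because both only involve products and evaluations of elements of the range of \<open>j\<close>.
\<close>

lemma cyclic_derivation_inner_along_hom:
  fixes sA :: "'k::real_normed_field \<Rightarrow> 'a::banach \<Rightarrow> 'a"
    and sC :: "'k \<Rightarrow> 'c::real_normed_vector \<Rightarrow> 'c"
  assumes A: "banach_algebra sA mA" and mC: "bounded_bilinear mC"
    and amen: "cyclicly_amenable sA mA"
    and D: "derivation_to_dual sC mC D" and cyc: "cyclic_map D"
    and j: "bounded_linear j" and j_scale: "\<And>k a. j (sA k a) = sC k (j a)"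
    and j_mult: "\<And>a b. j (mA a b) = mC (j a) (j b)"
  obtains f where "f \<in> dual_space sA" "\<And>a b. D (j a) (j b) = f (mA b a) - f (mA a b)"
proof -
  interpret A: banach_algebra sA mA by fact
  note mA = A.bounded_bilinear_mult
  define E where "E a = D (j a) o\<^sub>L Blinfun j" for a
  have E [simp]: "E a b = D (j a) (j b)" for a b
    by (simp add: E_def bounded_linear_Blinfun_apply j)
  have "Vector_Spaces.linear sC (*) (blinfun_apply (D x))" for x
    using D by (auto simp: derivation_to_dual_def dual_space_def)
  then have hom: "D x (sC k y) = k * D x y" for x k y
    by (simp add: Vector_Spaces.linear_iff)
  have vs: "vector_space ((*) :: 'k \<Rightarrow> 'k \<Rightarrow> 'k)"
    by standard (simp_all add: algebra_simps)
  have "derivation_to_dual sA mA E"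
    unfolding derivation_to_dual_def
  proof (intro conjI allI)
    show "range E \<subseteq> dual_space sA"
      by (auto simp: dual_space_def Vector_Spaces.linear_iff A.vector_space_axioms vs
          j_scale hom blinfun.add_right linear_add[OF bounded_linear.linear[OF j]])
    have "bounded_linear D"
      using D by (simp add: derivation_to_dual_def)
    then show "bounded_linear E"
      unfolding E_def
      by (intro bounded_linear_compose[OF
            bounded_bilinear.bounded_linear_left[OF bounded_bilinear_blinfun_compose]]
          bounded_linear_compose[OF _ j])
    show "E (sA k c) d = k * E c d" for k c d
      using D by (simp add: derivation_to_dual_def j_scale)
    show "E (mA x y) = dual_ract mA (E x) y + dual_lact mA x (E y)" for x y
      by (rule blinfun_eqI)
        (simp add: mA j_mult blinfun.add_left derivation_to_dual_mult[OF D mC])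
  qed
  moreover have "cyclic_map E"
    using cyc by (simp add: cyclic_map_def)
  ultimately obtain f where f: "f \<in> dual_space sA"
      "\<And>a. E a = dual_lact mA a f - dual_ract mA f a"
    using amen by (auto simp: cyclicly_amenable_def inner_map_def)
  then have "E a b = f (mA b a) - f (mA a b)" for a b
    by (simp add: mA blinfun.diff_left)
  then show ?thesis
    using f(1) that by simp
qed

lemma bounded_linear_dup:
  "bounded_linear (\<lambda>a. Dup a 0)" "bounded_linear (\<lambda>\<beta>. Dup 0 \<beta>)"
  "bounded_linear dfst" "bounded_linear dsnd"
  by (rule bounded_linear_intro[where K = 1];
      simp add: plus_dup_def scaleR_dup_def norm_dup_def)+

lemma (in banach_bimodule) dual_space_dup:
  assumes "f \<in> dual_space sA" "g \<in> dual_space sB"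
  shows "(f o\<^sub>L Blinfun dfst) + (g o\<^sub>L Blinfun dsnd) \<in> dual_space (dup_scale sA sB)"
proof -
  interpret C: banach_space_over "dup_scale sA sB"
    using space.banach_space_over_dup_scale alg.banach_space_over_axioms by blast
  show ?thesis
    using assms
    by (auto simp: dual_space_def Vector_Spaces.linear_iff C.vector_space_axioms
        bounded_linear_Blinfun_apply bounded_linear_dup blinfun.add_left blinfun.add_right
        dup_scale_def distrib_left)
qed

text \<open>
  The derivation rule moves \<open>\<gamma>\<close> onto one of the factors, where the implementing functional of the
  restriction to the ideal applies. The terms \<open>f ((y \<cdot> \<gamma>) x)\<close> and \<open>f (y (\<gamma> \<cdot> x))\<close> cancel.
\<close>

lemma (in banach_bimodule) mixed_value_on_product:
  assumes A: "banach_algebra sA mA" and comp: "compatible_actions mA lact ract"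
    and D: "derivation_to_dual (dup_scale sA sB) (dup_mult mA mB lact ract) D"
    and f: "\<And>a b. D (Dup a 0) (Dup b 0) = f (mA b a) - f (mA a b)"
  shows "D (Dup (mA x y) 0) (Dup 0 \<gamma>) = f (lact \<gamma> (mA x y)) - f (ract (mA x y) \<gamma>)"
proof -
  interpret A: banach_algebra sA mA by fact
  interpret l: bounded_bilinear lact by (rule bounded_bilinear_lact)
  interpret r: bounded_bilinear ract by (rule bounded_bilinear_ract)
  interpret mA: bounded_bilinear mA by (rule A.bounded_bilinear_mult)
  interpret mB: bounded_bilinear mB by (rule alg.bounded_bilinear_mult)
  have "D (Dup (mA x y) 0) (Dup 0 \<gamma>) = D (Dup x 0) (Dup (ract y \<gamma>) 0) + D (Dup y 0) (Dup (lact \<gamma> x) 0)"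
    using derivation_to_dual_mult[OF D bounded_bilinear_dup_mult[OF A],
        of "Dup x 0" "Dup y 0" "Dup 0 \<gamma>"]
    by (simp add: l.zero_left r.zero_right l.zero_right r.zero_left mA.zero_left mA.zero_right
        mB.zero_left mB.zero_right)
  also have "\<dots> = f (lact \<gamma> (mA x y)) - f (ract (mA x y) \<gamma>)"
    using comp by (simp add: f compatible_actions_def)
  finally show ?thesis .
qed

theorem theorem5p5:
  fixes sA :: "'k::real_normed_field \<Rightarrow> 'a::banach \<Rightarrow> 'a"
    and mA :: "'a \<Rightarrow> 'a \<Rightarrow> 'a"
    and sB :: "'k \<Rightarrow> 'b::banach \<Rightarrow> 'b"
    and mB :: "'b \<Rightarrow> 'b \<Rightarrow> 'b"
    and lact :: "'b \<Rightarrow> 'a \<Rightarrow> 'a"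
    and ract :: "'a \<Rightarrow> 'b \<Rightarrow> 'a"
  assumes "banach_algebra sA mA"
    and "banach_algebra sB mB"
    and "banach_bimodule sB mB sA lact ract"
    and "compatible_actions mA lact ract"
    and "cyclicly_amenable sA mA"
    and "cyclicly_amenable sB mB"
    and "closure (module.span sA {mA a b | a b. True}) = UNIV"
  shows "cyclicly_amenable (dup_scale sA sB) (dup_mult mA mB lact ract)"
  unfolding cyclicly_amenable_def
proof (intro allI impI, elim conjE)
  let ?s = "dup_scale sA sB" and ?m = "dup_mult mA mB lact ract"
  fix D
  assume D: "derivation_to_dual ?s ?m D" and cyc: "cyclic_map D"
  interpret A: banach_algebra sA mA by fact
  interpret banach_bimodule sB mB sA lact ract by fact
  interpret l: bounded_bilinear lact by (rule bounded_bilinear_lact)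
  interpret r: bounded_bilinear ract by (rule bounded_bilinear_ract)
  interpret mA: bounded_bilinear mA by (rule A.bounded_bilinear_mult)
  interpret mB: bounded_bilinear mB by (rule alg.bounded_bilinear_mult)
  note zeros = l.zero_left r.zero_right l.zero_right r.zero_left mA.zero_left mA.zero_right
    mB.zero_left mB.zero_right
  have m: "bounded_bilinear ?m"
    by (rule bounded_bilinear_dup_mult) fact
  obtain f where f: "f \<in> dual_space sA"
      "\<And>a b. D (Dup a 0) (Dup b 0) = f (mA b a) - f (mA a b)"
    by (rule cyclic_derivation_inner_along_hom[OF assms(1) m assms(5) D cyc bounded_linear_dup(1)])
      (auto simp: dup_scale_def zeros)
  obtain g where g: "g \<in> dual_space sB"
      "\<And>\<beta> \<gamma>. D (Dup 0 \<beta>) (Dup 0 \<gamma>) = g (mB \<gamma> \<beta>) - g (mB \<beta> \<gamma>)"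
    by (rule cyclic_derivation_inner_along_hom[OF assms(2) m assms(6) D cyc bounded_linear_dup(2)])
      (auto simp: dup_scale_def zeros)
  have D_lin: "bounded_linear D" and D_scale: "D (?s k c) d = k * D c d" for k c d
    using D by (auto simp: derivation_to_dual_def)
  have f_scale: "f (sA k a) = k * f a" for k a
    using f(1) by (simp add: dual_space_def Vector_Spaces.linear_iff)
  have mixed: "D (Dup a 0) (Dup 0 \<gamma>) = f (lact \<gamma> a) - f (ract a \<gamma>)" for a \<gamma>
  proof -
    define h where "h a = D (Dup a 0) (Dup 0 \<gamma>) - (f (lact \<gamma> a) - f (ract a \<gamma>))" for a
    have h: "bounded_linear h"
      unfolding h_def
      by (intro bounded_linear_sub
          bounded_linear_compose[OF bounded_bilinear.bounded_linear_left[OF bounded_bilinear_blinfun_apply]]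
          bounded_linear_compose[OF D_lin] bounded_linear_dup
          bounded_linear_compose[OF blinfun.bounded_linear_right]
          l.bounded_linear_right r.bounded_linear_left)
    have h_scale: "h (sA k a) = k * h a" for k a
      using D_scale[of k "Dup a 0"]
      by (simp add: h_def dup_scale_def bilinear_overD[OF lact_bilinear]
          bilinear_overD[OF ract_bilinear] f_scale algebra_simps)
    have "A.subspace {a. h a = 0}"
      by (simp add: A.subspace_def h_scale linear_0[OF bounded_linear.linear[OF h]]
          linear_add[OF bounded_linear.linear[OF h]])
    moreover have "{mA a b | a b. True} \<subseteq> {a. h a = 0}"
      using mixed_value_on_product[OF assms(1,4) D f(2)] by (auto simp: h_def)
    ultimately have "A.span {mA a b | a b. True} \<subseteq> {a. h a = 0}"
      by (intro A.span_minimal)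
    moreover have "closed {a. h a = 0}"
      by (intro closed_Collect_eq linear_continuous_on h continuous_on_const)
    ultimately have "closure (A.span {mA a b | a b. True}) \<subseteq> {a. h a = 0}"
      by (rule closure_minimal)
    then show ?thesis
      using assms(7) by (auto simp: h_def)
  qed
  define \<phi> where "\<phi> = (f o\<^sub>L Blinfun dfst) + (g o\<^sub>L Blinfun dsnd)"
  have \<phi>: "\<phi> c = f (dfst c) + g (dsnd c)" for c
    by (simp add: \<phi>_def blinfun.add_left bounded_linear_Blinfun_apply bounded_linear_dup)
  have "D c d = \<phi> (?m d c) - \<phi> (?m c d)" for c d
  proof (cases c; cases d)
    fix a \<beta> b \<gamma>
    assume c: "c = Dup a \<beta>" and d: "d = Dup b \<gamma>"
    have "c = Dup a 0 + Dup 0 \<beta>" "d = Dup b 0 + Dup 0 \<gamma>"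
      by (simp_all add: c d plus_dup_def)
    then have "D c d = D (Dup a 0) (Dup b 0) + D (Dup a 0) (Dup 0 \<gamma>)
        + D (Dup 0 \<beta>) (Dup b 0) + D (Dup 0 \<beta>) (Dup 0 \<gamma>)"
      by (simp add: linear_add[OF bounded_linear.linear[OF D_lin]] blinfun.add_left
          blinfun.add_right)
    moreover have "D (Dup 0 \<beta>) (Dup b 0) = - D (Dup b 0) (Dup 0 \<beta>)"
      using cyc by (simp add: cyclic_map_def eq_neg_iff_add_eq_0)
    ultimately show ?thesis
      by (simp add: f(2) g(2) mixed \<phi> c d blinfun.add_right)
  qed
  then have "D c = dual_lact ?m c \<phi> - dual_ract ?m \<phi> c" for c
    by (intro blinfun_eqI) (simp add: m blinfun.diff_left)
  moreover have "\<phi> \<in> dual_space ?s"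
    unfolding \<phi>_def by (rule dual_space_dup) (use f g in auto)
  ultimately show "inner_map ?s ?m D"
    unfolding inner_map_def by blast
qed

end
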